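(* Let $(f,\nu)$ be a standard scheme on the countable set $\mathcal{D}$ and let $\mathbf{u}=\{u_I\}_{I\in\mathcal{D}}$ be a weight sequence. Fix $\xi>0$ and $\mu\in(0,\infty]$. Then, for any function $\eta\in\mathbb{W}$, the following are equivalent: 1) There exists $C>0$ such that for all $\Gamma\subset\mathcal{D}$ with $\nu(\Gamma)<\infty$, $$\frac1C\,\eta(\nu(\Gamma))\le\Big\|\sum_{I\in\Gamma}\frac{\mathbf{e}_I}{u_I}\Big\|_f.$$ 2) The space $\ell^\mu_{\xi,\eta}(\mathbf{u},\nu)$ satisfies Bernstein's inequality of order $\xi$, that is, there exists $C>0$ such that for all $t>0$, $$\|\mathbf{s}\|_{\ell^\mu_{\xi,\eta}(\mathbf{u},\nu)}\le C\,t^\xi\,\|\mathbf{s}\|_f\quad\text{for all }\mathbf{s}\in\Sigma_{t,\nu}\cap f.$$ 3) $\mathcal{A}^\xi_\mu(f,\nu)\hookrightarrow\ell^\mu_{\xi,\eta}(\mathbf{u},\nu)$ (continuous inclusion).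
   Context: $\mathcal{D}$ is a countable index set, $S=\mathbb{C}^{\mathcal{D}}$ is the set of all complex sequences $\mathbf{s}=\{s_I\}_{I\in\mathcal{D}}$, and $\mathbf{e}_I\in S$ has entry $1$ at $I$ and $0$ elsewhere. For $\Gamma\subset\mathcal{D}$ (possibly infinite), $\sum_{I\in\Gamma}s_I\mathbf{e}_I$ denotes the element of $S$ whose entry is $s_I$ for $I\in\Gamma$ and $0$ otherwise (no convergence is meant). A quasi-Banach (sequence) lattice is a linear space $f\subset S$ with a quasi-norm $\|\cdot\|_f$ for which $f$ is complete and such that: (a) if $\mathbf{t}\in f$ and $|s_I|\le|t_I|$ for all $I$, then $\mathbf{s}\in f$ and $\|\mathbf{s}\|_f\le\|\mathbf{t}\|_f$; (b) if $\mathbf{s}\in f$, then $\lim_{n\to\infty}\|s_{I_n}\mathbf{e}_{I_n}\|_f=0$ for some enumeration $\{I_1,I_2,\dots\}$ of $\mathcal{D}$. It is embedded in $S$ if $\|\mathbf{s}^{n}-\mathbf{s}\|_f\to0$ implies $s^{(n)}_I\to s_I$ for all $I\in\mathcal{D}$. Convention: $\|\mathbf{s}\|_f=\infty$ if $\mathbf{s}\in S\setminus f$. A standard scheme $(f,\nu)$ consists of a quasi-Banach lattice $f$ embedded in $S$ and a positive measure $\nu$ on $\mathcal{D}$ with $\nu(I)>0$ for all $I\in\mathcal{D}$. A weight sequence is a sequence $\mathbf{u}=\{u_I\}_{I\in\mathcal{D}}$ with $u_I>0$ for all $I$. For $t>0$, $\Sigma_{t,\nu}=\{\sum_{I\in\Gamma}t_I\mathbf{e}_I:\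 \Gamma\subset\mathcal{D},\ \nu(\Gamma)\le t\}$, and for $\mathbf{s}\in S$, $\sigma_\nu(t,\mathbf{s})=\inf_{\mathbf{t}\in\Sigma_{t,\nu}}\|\mathbf{s}-\mathbf{t}\|_f$. The restricted approximation space $\mathcal{A}^\xi_\mu(f,\nu)$ ($0<\xi<\infty$, $0<\mu\le\infty$) is the set of $\mathbf{s}\in S$ with $\|\mathbf{s}\|_{\mathcal{A}^\xi_\mu(f,\nu)}=\big(\int_0^\infty[t^\xi\sigma_\nu(t,\mathbf{s})]^\mu\frac{dt}{t}\big)^{1/\mu}<\infty$ if $\mu<\infty$, and $\|\mathbf{s}\|_{\mathcal{A}^\xi_\infty(f,\nu)}=\sup_{t>0}t^\xi\sigma_\nu(t,\mathbf{s})<\infty$ if $\mu=\infty$. $\mathbb{W}$ is the set of continuous non-decreasing $\eta:[0,\infty)\to[0,\infty)$ with $\eta(0)=0$, $\lim_{t\to\infty}\eta(t)=\infty$, and $\eta(2t)\le C\eta(t)$ for all $t>0$ and some $C>0$. For $\mathbf{s}\in S$, $\mathbf{s}^\ast_\nu(t)=\inf\{\lambda>0:\nu(\{I:|s_I|>\lambda\})\le t\}$. For $\eta\in\mathbb{W}$, $\ell^\mu_\eta(\nu)$ is the set of $\mathbf{s}\in S$ with $\|\mathbf{s}\|_{\ell^\mu_\eta(\nu)}=\big(\int_0^\infty[\eta(t)\mathbf{s}^\ast_\nu(t)]^\mu\frac{dt}{t}\big)^{1/\mu}<\infty$ (for $\mu=\infty$: $\sup_{t>0}\eta(t)\mathbf{s}^\ast_\nu(t)<\infty$).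 $\ell^\mu_\eta(\mathbf{u},\nu)$ is the set of $\mathbf{s}\in S$ with $\|\mathbf{s}\|_{\ell^\mu_\eta(\mathbf{u},\nu)}=\|\{u_Is_I\}_{I}\|_{\ell^\mu_\eta(\nu)}<\infty$. For $\xi>0$, $\ell^\mu_{\xi,\eta}(\mathbf{u},\nu)$ denotes $\ell^\mu_{\tilde\eta}(\mathbf{u},\nu)$ with $\tilde\eta(t)=t^\xi\eta(t)$. *)

theory Defs
  imports "HOL-Analysis.Analysis"
begin

text \<open>The countable index set is a type of class \<open>countable\<close>; sequences are functions on it.\<close>

type_synonym 'd cseq = "'d \<Rightarrow> complex"

text \<open>The formal sum of \<open>s I\<close> times the unit sequence at \<open>I\<close>, over \<open>I \<in> \<Gamma>\<close>.\<close>

definition restrict_seq :: "'d set \<Rightarrow> 'd cseq \<Rightarrow> 'd cseq" where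
  "restrict_seq \<Gamma> s = (\<lambda>I. if I \<in> \<Gamma> then s I else 0)"

definition linear_subspace :: "'d cseq set \<Rightarrow> bool" where
  "linear_subspace f \<longleftrightarrow>
     (\<lambda>I. 0) \<in> f \<and>
     (\<forall>s\<in>f. \<forall>t\<in>f. (\<lambda>I. s I + t I) \<in> f) \<and>
     (\<forall>c. \<forall>s\<in>f. (\<lambda>I. c * s I) \<in> f)"

definition quasi_norm_on :: "'d cseq set \<Rightarrow> ('d cseq \<Rightarrow> real) \<Rightarrow> bool" where
  "quasi_norm_on f N \<longleftrightarrow>
     (\<forall>s\<in>f. 0 \<le> N s) \<and>
     (\<forall>s\<in>f. N s = 0 \<longleftrightarrow> s = (\<lambda>I. 0)) \<and>
     (\<forall>c. \<forall>s\<in>f. N (\<lambda>I. c * s I) = norm c * N s) \<and>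
     (\<exists>K\<ge>1. \<forall>s\<in>f. \<forall>t\<in>f. N (\<lambda>I. s I + t I) \<le> K * (N s + N t))"

definition quasi_norm_complete :: "'d cseq set \<Rightarrow> ('d cseq \<Rightarrow> real) \<Rightarrow> bool" where
  "quasi_norm_complete f N \<longleftrightarrow>
     (\<forall>x :: nat \<Rightarrow> 'd cseq.
        (\<forall>n. x n \<in> f) \<longrightarrow>
        (\<forall>\<epsilon>>0. \<exists>M. \<forall>m\<ge>M. \<forall>n\<ge>M. N (\<lambda>I. x m I - x n I) < \<epsilon>) \<longrightarrow>
        (\<exists>l\<in>f. (\<lambda>n. N (\<lambda>I. x n I - l I)) \<longlonglongrightarrow> 0))"

text \<open>The last clause is empty for a finite index set, where there is no infinite enumeration.
  The values of \<open>N\<close> outside \<open>f\<close> are irrelevant.\<close>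

definition quasi_banach_lattice ::
    "('d::countable) cseq set \<Rightarrow> ('d cseq \<Rightarrow> real) \<Rightarrow> bool" where
  "quasi_banach_lattice f N \<longleftrightarrow>
     linear_subspace f \<and> quasi_norm_on f N \<and> quasi_norm_complete f N \<and>
     (\<forall>t\<in>f. \<forall>s. (\<forall>I. norm (s I) \<le> norm (t I)) \<longrightarrow> s \<in> f \<and> N s \<le> N t) \<and>
     (\<forall>s\<in>f. infinite (UNIV :: 'd set) \<longrightarrow>
        (\<exists>e :: nat \<Rightarrow> 'd. bij e \<and> (\<lambda>n. N (restrict_seq {e n} s)) \<longlonglongrightarrow> 0))"

definition embedded_in_S :: "'d cseq set \<Rightarrow> ('d cseq \<Rightarrow> real) \<Rightarrow> bool" where
  "embedded_in_S f N \<longleftrightarrow>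
     (\<forall>(x :: nat \<Rightarrow> 'd cseq). \<forall>s\<in>f. (\<forall>n. x n \<in> f) \<longrightarrow>
        (\<lambda>n. N (\<lambda>I. x n I - s I)) \<longlonglongrightarrow> 0 \<longrightarrow>
        (\<forall>I. (\<lambda>n. x n I) \<longlonglongrightarrow> s I))"

definition ext_norm :: "'d cseq set \<Rightarrow> ('d cseq \<Rightarrow> real) \<Rightarrow> 'd cseq \<Rightarrow> ennreal" where
  "ext_norm f N s = (if s \<in> f then ennreal (N s) else \<infinity>)"

text \<open>Atoms and infinite sets of infinite measure are allowed.\<close>

definition standard_scheme ::
    "('d::countable) cseq set \<Rightarrow> ('d cseq \<Rightarrow> real) \<Rightarrow> 'd measure \<Rightarrow> bool" where
  "standard_scheme f N \<nu> \<longleftrightarrow>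
     quasi_banach_lattice f N \<and> embedded_in_S f N \<and>
     sets \<nu> = UNIV \<and> (\<forall>I. emeasure \<nu> {I} > 0)"

definition weight_sequence :: "('d \<Rightarrow> real) \<Rightarrow> bool" where
  "weight_sequence u \<longleftrightarrow> (\<forall>I. u I > 0)"

definition Sigma_set :: "'d measure \<Rightarrow> real \<Rightarrow> 'd cseq set" where
  "Sigma_set \<nu> t = {restrict_seq \<Gamma> s | \<Gamma> s. emeasure \<nu> \<Gamma> \<le> ennreal t}"

definition approx_error ::
    "'d cseq set \<Rightarrow> ('d cseq \<Rightarrow> real) \<Rightarrow> 'd measure \<Rightarrow> real \<Rightarrow> 'd cseq \<Rightarrow> ennreal" where
  "approx_error f N \<nu> t s = (INF r\<in>Sigma_set \<nu> t. ext_norm f N (\<lambda>I. s I - r I))"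

text \<open>Powers with positive real exponent on \<open>[0, \<infinity>]\<close>.\<close>

definition ennpowr :: "ennreal \<Rightarrow> real \<Rightarrow> ennreal" where
  "ennpowr x p = (if x = \<infinity> then \<infinity> else ennreal (enn2real x powr p))"

text \<open>The \<open>L\<^sup>\<mu>\<close> quasi-norm on \<open>(0, \<infinity>)\<close> with respect to \<open>dt/t\<close>; for \<open>\<mu> = \<infinity>\<close> the pointwise
  supremum, not the essential one.\<close>

definition Lmu_norm :: "ennreal \<Rightarrow> (real \<Rightarrow> ennreal) \<Rightarrow> ennreal" where
  "Lmu_norm \<mu> g =
     (if \<mu> = \<infinity> then (SUP t\<in>{0<..}. g t)
      else ennpowr (\<integral>\<^sup>+t\<in>{0<..}. (ennpowr (g t) (enn2real \<mu>) * ennreal (1 / t)) \<partial>lborel)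
             (1 / enn2real \<mu>))"

definition approx_norm ::
    "real \<Rightarrow> ennreal \<Rightarrow> 'd cseq set \<Rightarrow> ('d cseq \<Rightarrow> real) \<Rightarrow> 'd measure \<Rightarrow> 'd cseq \<Rightarrow> ennreal" where
  "approx_norm \<xi> \<mu> f N \<nu> s =
     Lmu_norm \<mu> (\<lambda>t. ennreal (t powr \<xi>) * approx_error f N \<nu> t s)"

definition approx_space ::
    "real \<Rightarrow> ennreal \<Rightarrow> 'd cseq set \<Rightarrow> ('d cseq \<Rightarrow> real) \<Rightarrow> 'd measure \<Rightarrow> 'd cseq set" where
  "approx_space \<xi> \<mu> f N \<nu> = {s. approx_norm \<xi> \<mu> f N \<nu> s < \<infinity>}"

text \<open>Only the values of \<open>\<eta>\<close> on \<open>[0, \<infinity>)\<close> matter.\<close>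

definition W_class :: "(real \<Rightarrow> real) set" where
  "W_class = {\<eta>. continuous_on {0..} \<eta> \<and> mono_on {0..} \<eta> \<and> (\<forall>t\<ge>0. \<eta> t \<ge> 0) \<and> \<eta> 0 = 0 \<and>
     filterlim \<eta> at_top at_top \<and> (\<exists>C>0. \<forall>t>0. \<eta> (2 * t) \<le> C * \<eta> t)}"

text \<open>The infimum is taken in \<open>[0, \<infinity>]\<close>, so it is \<open>\<infinity>\<close> over the empty set.\<close>

definition decr_rearr :: "'d measure \<Rightarrow> 'd cseq \<Rightarrow> real \<Rightarrow> ennreal" where
  "decr_rearr \<nu> s t =
     (INF y\<in>{y::real. y > 0 \<and> emeasure \<nu> {I. norm (s I) > y} \<le> ennreal t}. ennreal y)"

definition lorentz_norm ::
    "ennreal \<Rightarrow> (real \<Rightarrow> real) \<Rightarrow> 'd measure \<Rightarrow> 'd cseq \<Rightarrow> ennreal" where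
  "lorentz_norm \<mu> \<eta> \<nu> s = Lmu_norm \<mu> (\<lambda>t. ennreal (\<eta> t) * decr_rearr \<nu> s t)"

definition wlorentz_norm ::
    "ennreal \<Rightarrow> (real \<Rightarrow> real) \<Rightarrow> ('d \<Rightarrow> real) \<Rightarrow> 'd measure \<Rightarrow> 'd cseq \<Rightarrow> ennreal" where
  "wlorentz_norm \<mu> \<eta> u \<nu> s = lorentz_norm \<mu> \<eta> \<nu> (\<lambda>I. complex_of_real (u I) * s I)"

definition wlorentz_xi_norm ::
    "ennreal \<Rightarrow> real \<Rightarrow> (real \<Rightarrow> real) \<Rightarrow> ('d \<Rightarrow> real) \<Rightarrow> 'd measure \<Rightarrow> 'd cseq \<Rightarrow> ennreal" where
  "wlorentz_xi_norm \<mu> \<xi> \<eta> u \<nu> = wlorentz_norm \<mu> (\<lambda>t. t powr \<xi> * \<eta> t) u \<nu>"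

definition wlorentz_xi_space ::
    "ennreal \<Rightarrow> real \<Rightarrow> (real \<Rightarrow> real) \<Rightarrow> ('d \<Rightarrow> real) \<Rightarrow> 'd measure \<Rightarrow> 'd cseq set" where
  "wlorentz_xi_space \<mu> \<xi> \<eta> u \<nu> = {s. wlorentz_xi_norm \<mu> \<xi> \<eta> u \<nu> s < \<infinity>}"

definition bernstein_inequality ::
    "real \<Rightarrow> ('d cseq \<Rightarrow> ennreal) \<Rightarrow> 'd cseq set \<Rightarrow> ('d cseq \<Rightarrow> real) \<Rightarrow> 'd measure \<Rightarrow> bool" where
  "bernstein_inequality \<xi> M f N \<nu> \<longleftrightarrow>
     (\<exists>C>0. \<forall>t>0. \<forall>s \<in> Sigma_set \<nu> t \<inter> f.
        M s \<le> ennreal (C * t powr \<xi>) * ext_norm f N s)"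

definition continuous_inclusion ::
    "'d cseq set \<Rightarrow> ('d cseq \<Rightarrow> ennreal) \<Rightarrow> 'd cseq set \<Rightarrow> ('d cseq \<Rightarrow> ennreal) \<Rightarrow> bool" where
  "continuous_inclusion A MA B MB \<longleftrightarrow>
     A \<subseteq> B \<and> (\<exists>C>0. \<forall>s\<in>A. MB s \<le> ennreal C * MA s)"

end

theory Submission
  imports Defs
begin

text \<open>The three statements form a cycle: 1) gives 3), 3) gives 2), 2) gives 1). Below,
  sigma(t, s) is the approximation error and R(s, t) the decreasing rearrangement.

  From 1) to 3): the lower estimate self-improves to a weak-type bound on f. If |u_I g_I| > y on a
  set G of finite measure nu(G) > tau, then y times the sum of e_I / u_I over G is dominated by g
  entrywise, so the lattice property yields y eta(tau) <= C ||g||_f; hence eta(tau) R(ug, tau) <= C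
  ||g||_f (\<open>lower_estimate_imp_weak_type\<close>). If r is supported on a set of measure at
  most t, then R(us, 2t) <= R(u(s - r), t) (\<open>decr_rearr_minus_Sigma_set\<close>). Taking the
  infimum over such r gives eta(t) R(us, 2t) <= C sigma(t, s) for each t > 0. The doubling of eta
  and the dilation invariance of dt/t (\<open>Lmu_norm_dilation_le\<close>) turn this pointwise
  bound into the embedding. Since 1) is silent about sets of infinite measure, one also has to know
  that elements of the approximation space vanish on atoms of infinite measure
  (\<open>approx_norm_infinite_atom\<close>).

  From 3) to 2): if s lies in Sigma_t, its error is at most ||s||_f before t and zero from t on, so
  its approximation norm is at most a constant times t^xi ||s||_f (\<open>Lmu_norm_upper\<close>).

  From 2) to 1): test Bernstein's inequality on the sum of e_I / u_I over Gamma with t = nu(Gamma).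
  After multiplication by u this is an indicator, whose rearrangement is at least 1 below nu(Gamma),
  so its Lorentz norm is bounded below by a multiple of nu(Gamma)^xi eta(nu(Gamma))
  (\<open>Lmu_norm_lower\<close> and doubling).\<close>

section \<open>Powers in [0, infinity] and estimates for the quasi-norm of L^mu(dt/t)\<close>

lemma ennpowr_mono: "x \<le> y \<Longrightarrow> 0 \<le> p \<Longrightarrow> ennpowr x p \<le> ennpowr y p"
  unfolding ennpowr_def
  by (auto simp: top_unique infinity_ennreal_def less_top intro!: ennreal_leI powr_mono2 enn2real_mono)

lemma ennpowr_cmult:
  assumes "c > 0"
  shows "ennpowr (ennreal c * x) p = ennreal (c powr p) * ennpowr x p"
proof (cases "x = \<infinity>")
  case True
  then show ?thesis using assms
    by (simp add: ennpowr_def ennreal_mult_top infinity_ennreal_def)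
next
  case False
  then show ?thesis using assms
    by (simp add: ennpowr_def infinity_ennreal_def ennreal_mult_eq_top_iff enn2real_mult
        powr_mult ennreal_mult)
qed

lemma ennpowr_ennpowr: "p \<noteq> 0 \<Longrightarrow> ennpowr (ennpowr x p) (1 / p) = x"
  by (auto simp: ennpowr_def infinity_ennreal_def powr_powr less_top)

lemma borel_measurable_ennpowr [measurable]:
  "(\<lambda>x. ennpowr x p) \<in> borel_measurable borel"
  unfolding ennpowr_def by measurable

text \<open>The interval [T, 2T] has dt/t-mass at least 1/2 whatever T is, so the constant is
  uniform in T; for infinite mu a single point of the interval suffices.\<close>

lemma Lmu_norm_lower:
  assumes "0 < \<mu>"
  shows "\<exists>k>0. \<forall>g a T. T > 0 \<longrightarrow> (\<forall>t\<in>{T..2*T}. a \<le> g t) \<longrightarrow> ennreal k * a \<le> Lmu_norm \<mu> g"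
proof (cases "\<mu> = \<infinity>")
  case True
  have "ennreal 1 * a \<le> Lmu_norm \<mu> g" if "T > 0" "\<forall>t\<in>{T..2*T}. a \<le> g t" for g a and T :: real
  proof -
    have "a \<le> g T" using that by auto
    also have "g T \<le> (SUP t\<in>{0<..}. g t)" using that by (intro SUP_upper) auto
    finally show ?thesis using True by (simp add: Lmu_norm_def)
  qed
  then show ?thesis by (intro exI[of _ 1]) auto
next
  case False
  define p where "p = enn2real \<mu>"
  have p: "p > 0" using assms False by (simp add: p_def enn2real_positive_iff infinity_ennreal_def less_top[symmetric])
  have "ennreal ((1/2) powr (1/p)) * a \<le> Lmu_norm \<mu> g"
    if T: "T > 0" and a: "\<forall>t\<in>{T..2*T}. a \<le> g t" for g a and T :: real
  proof -
    have "ennreal (1/2) * ennpowr a p = (ennpowr a p * ennreal (1 / (2*T))) * ennreal T"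
      using T by (simp add: mult.assoc flip: ennreal_mult) (simp add: mult.commute)
    also have "\<dots> = (ennpowr a p * ennreal (1 / (2*T))) * emeasure lborel {T..2*T}"
      using T by simp
    also have "\<dots> = (\<integral>\<^sup>+t. (ennpowr a p * ennreal (1 / (2*T))) * indicator {T..2*T} t \<partial>lborel)"
      by (subst nn_integral_cmult_indicator) auto
    also have "\<dots> \<le> (\<integral>\<^sup>+t\<in>{0<..}. (ennpowr (g t) p * ennreal (1 / t)) \<partial>lborel)"
    proof (intro nn_integral_mono)
      fix t :: real
      show "(ennpowr a p * ennreal (1 / (2*T))) * indicator {T..2*T} t
          \<le> ennpowr (g t) p * ennreal (1 / t) * indicator {0<..} t"
        using T a p
        by (cases "t \<in> {T..2*T}")
          (auto intro!: mult_mono ennpowr_mono ennreal_leI divide_left_mono)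
    qed
    finally have "ennpowr (ennreal (1/2) * ennpowr a p) (1/p) \<le> Lmu_norm \<mu> g"
      using p False unfolding Lmu_norm_def p_def by (auto intro!: ennpowr_mono)
    then show ?thesis using p by (subst (asm) ennpowr_cmult) (auto simp: ennpowr_ennpowr)
  qed
  then show ?thesis by (intro exI[of _ "(1/2) powr (1/p)"]) auto
qed

lemma nn_integral_powr_from_0:
  fixes q m :: real
  assumes "q > 0" "m \<ge> 0"
  shows "(\<integral>\<^sup>+t. ennreal (t powr (q - 1)) * indicator {0..m} t \<partial>lborel) = ennreal (m powr q / q)"
proof -
  have "((\<lambda>t. t powr (q - 1)) has_integral (m powr q / q)) {0..m}"
    using has_integral_powr_from_0[of "q - 1" m] assms by simp
  then show ?thesis
    by (intro nn_integral_has_integral_lebesgue') auto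
qed

text \<open>For finite mu this is the integral of t^(xi mu) dt/t over (0, m), which equals m^(xi mu)
  / (xi mu). The shape of the bound on \<open>g\<close> is that of the weighted approximation error
  of an element of Sigma_m.\<close>

lemma Lmu_norm_upper:
  assumes "0 < \<mu>" "0 < \<xi>"
  shows "\<exists>k>0. \<forall>g a m. m > 0 \<longrightarrow> (\<forall>t>0. g t \<le> (if t < m then ennreal (t powr \<xi>) * a else 0)) \<longrightarrow>
            Lmu_norm \<mu> g \<le> ennreal (k * m powr \<xi>) * a"
proof (cases "\<mu> = \<infinity>")
  case True
  have "Lmu_norm \<mu> g \<le> ennreal (1 * m powr \<xi>) * a"
    if "m > 0" and g: "\<forall>t>0. g t \<le> (if t < m then ennreal (t powr \<xi>) * a else 0)"
    for g a and m :: real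
  proof -
    have "g t \<le> ennreal (m powr \<xi>) * a" if "t > 0" for t
      using g[rule_format, OF that] that assms
      by (cases "t < m")
        (auto intro!: order.trans[of "g t" "ennreal (t powr \<xi>) * a"] mult_right_mono ennreal_leI powr_mono2)
    then show ?thesis using True by (auto simp: Lmu_norm_def intro!: SUP_least)
  qed
  then show ?thesis by (intro exI[of _ 1] conjI zero_less_one) blast
next
  case False
  define p where "p = enn2real \<mu>"
  have p: "p > 0" using assms False by (simp add: p_def enn2real_positive_iff infinity_ennreal_def less_top[symmetric])
  define q where "q = \<xi> * p"
  have q: "q > 0" using p assms by (simp add: q_def)
  have "Lmu_norm \<mu> g \<le> ennreal ((1/q) powr (1/p) * m powr \<xi>) * a"
    if m: "m > 0" and g: "\<forall>t>0. g t \<le> (if t < m then ennreal (t powr \<xi>) * a else 0)"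
    for g a and m :: real
  proof -
    have "(\<integral>\<^sup>+t\<in>{0<..}. (ennpowr (g t) p * ennreal (1 / t)) \<partial>lborel)
        \<le> (\<integral>\<^sup>+t. ennpowr a p * (ennreal (t powr (q - 1)) * indicator {0..m} t) \<partial>lborel)"
    proof (intro nn_integral_mono)
      fix t :: real
      show "ennpowr (g t) p * ennreal (1 / t) * indicator {0<..} t
          \<le> ennpowr a p * (ennreal (t powr (q - 1)) * indicator {0..m} t)"
      proof (cases "t > 0 \<and> t < m")
        case True
        then have "ennpowr (g t) p \<le> ennpowr (ennreal (t powr \<xi>) * a) p"
          using g p by (intro ennpowr_mono) auto
        also have "\<dots> = ennreal (t powr q) * ennpowr a p"
          using True by (subst ennpowr_cmult) (auto simp: powr_powr q_def)
        finally have "ennpowr (g t) p * ennreal (1/t) \<le> (ennreal (t powr q) * ennpowr a p) * ennreal (1/t)"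
          by (rule mult_right_mono) simp
        also have "\<dots> = ennpowr a p * (ennreal (t powr q) * ennreal (1/t))"
          by (simp add: ac_simps)
        also have "ennreal (t powr q) * ennreal (1/t) = ennreal (t powr (q - 1))"
          using True by (simp add: powr_diff flip: ennreal_mult)
        finally show ?thesis using True by simp
      next
        case False
        then have "t \<le> 0 \<or> g t = 0" using g by (metis le_zero_eq not_le)
        then show ?thesis using p by (auto simp: ennpowr_def infinity_ennreal_def)
      qed
    qed
    also have "\<dots> = ennpowr a p * ennreal (m powr q / q)"
      using q m by (subst nn_integral_cmult) (auto simp: nn_integral_powr_from_0)
    also have "\<dots> = ennreal (m powr q / q) * ennpowr a p" by (rule mult.commute)
    finally have "Lmu_norm \<mu> g \<le> ennpowr (ennreal (m powr q / q) * ennpowr a p) (1/p)"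
      using p False unfolding Lmu_norm_def p_def by (auto intro!: ennpowr_mono)
    also have "\<dots> = ennreal ((m powr q / q) powr (1/p)) * a"
      using p q m by (subst ennpowr_cmult) (simp_all add: ennpowr_ennpowr)
    also have "(m powr q / q) powr (1/p) = (1/q) powr (1/p) * m powr \<xi>"
      using p q m by (simp add: powr_divide powr_powr q_def)
    finally show ?thesis .
  qed
  then show ?thesis using q by (intro exI[of _ "(1/q) powr (1/p)"]) auto
qed

text \<open>The measure dt/t is invariant under dilations, so t -> g(t/2) has the same norm as g.
  Measurability of \<open>g\<close> serves the change of variables; \<open>h\<close> enters through
  monotonicity of the integral.\<close>

lemma Lmu_norm_dilation_le:
  assumes "0 < \<mu>" "c > 0" and [measurable]: "g \<in> borel_measurable borel"
    and h: "\<And>t. t > 0 \<Longrightarrow> h t \<le> ennreal c * g (t / 2)"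
  shows "Lmu_norm \<mu> h \<le> ennreal c * Lmu_norm \<mu> g"
proof (cases "\<mu> = \<infinity>")
  case True
  have "h t \<le> ennreal c * (SUP t\<in>{0<..}. g t)" if "t > 0" for t
    using h[OF that] that
    by (elim order.trans) (auto intro!: mult_left_mono SUP_upper)
  then show ?thesis using True by (auto simp: Lmu_norm_def intro!: SUP_least)
next
  case False
  define p where "p = enn2real \<mu>"
  have p: "p > 0" using assms False by (simp add: p_def enn2real_positive_iff infinity_ennreal_def less_top[symmetric])
  define G where "G t = ennpowr (g t) p * ennreal (1/t) * indicator {0<..} t" for t :: real
  have [measurable]: "G \<in> borel_measurable borel" unfolding G_def by measurable
  have "(\<integral>\<^sup>+t\<in>{0<..}. (ennpowr (h t) p * ennreal (1 / t)) \<partial>lborel)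
      \<le> (\<integral>\<^sup>+t. ennreal (c powr p) * (ennreal (1/2) * G (0 + (1/2) * t)) \<partial>lborel)"
  proof (intro nn_integral_mono)
    fix t :: real
    show "ennpowr (h t) p * ennreal (1 / t) * indicator {0<..} t
        \<le> ennreal (c powr p) * (ennreal (1/2) * G (0 + (1/2) * t))"
    proof (cases "t > 0")
      case True
      have "ennpowr (h t) p \<le> ennpowr (ennreal c * g (t/2)) p"
        using h[OF True] p by (intro ennpowr_mono) auto
      also have "\<dots> = ennreal (c powr p) * ennpowr (g (t/2)) p"
        using assms by (simp add: ennpowr_cmult)
      finally have "ennpowr (h t) p * ennreal (1/t) \<le> ennreal (c powr p) * ennpowr (g (t/2)) p * ennreal (1/t)"
        by (rule mult_right_mono) simp
      \<comment> \<open>Splitting 1/t as 1/2 times 1/(t/2) isolates the Jacobian of the substitution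
        t -> t/2.\<close>
      also have "\<dots> = ennreal (c powr p) * ennpowr (g (t/2)) p * (ennreal (1/2) * ennreal (1/(t/2)))"
        using True by (subst ennreal_mult[symmetric]) auto
      also have "\<dots> = ennreal (c powr p) * (ennreal (1/2) * (ennpowr (g (t/2)) p * ennreal (1/(t/2))))"
        by (simp only: ac_simps)
      finally have "ennpowr (h t) p * ennreal (1/t)
          \<le> ennreal (c powr p) * (ennreal (1/2) * (ennpowr (g (t/2)) p * ennreal (1/(t/2))))" .
      then show ?thesis using True by (simp add: G_def)
    qed simp
  qed
  also have "\<dots> = ennreal (c powr p) * (ennreal \<bar>1/2\<bar> * (\<integral>\<^sup>+t. G (0 + (1/2) * t) \<partial>lborel))"
    by (simp add: nn_integral_cmult)
  also have "\<dots> = ennreal (c powr p) * (\<integral>\<^sup>+t. G t \<partial>lborel)"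
    by (subst (2) nn_integral_real_affine[where c = "1/2" and t = 0]) auto
  finally have "Lmu_norm \<mu> h \<le> ennpowr (ennreal (c powr p) * (\<integral>\<^sup>+t. G t \<partial>lborel)) (1/p)"
    using p False unfolding Lmu_norm_def p_def by (auto intro!: ennpowr_mono)
  also have "\<dots> = ennreal c * ennpowr (\<integral>\<^sup>+t. G t \<partial>lborel) (1/p)"
    using p assms by (subst ennpowr_cmult) (auto simp: powr_powr)
  also have "ennpowr (\<integral>\<^sup>+t. G t \<partial>lborel) (1/p) = Lmu_norm \<mu> g"
    using False by (simp add: Lmu_norm_def p_def G_def)
  finally show ?thesis .
qed

section \<open>Monotone functions, infima, and consequences of the lattice axioms\<close>

text \<open>Superlevel sets of a monotone function are intervals. This makes the approximation error
  measurable in t.\<close>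

lemma borel_measurable_antimono_ennreal:
  fixes g :: "real \<Rightarrow> ennreal"
  assumes "antimono g"
  shows "g \<in> borel_measurable borel"
proof (rule borel_measurableI_greater)
  fix y
  have "is_interval {x. y < g x}"
    unfolding is_interval_1 using assms by (auto dest: antimonoD intro: less_le_trans)
  then show "{x \<in> space borel. y < g x} \<in> sets borel"
    by (simp add: real_interval_borel_measurable)
qed

text \<open>A finite positive constant is invertible in \<open>ennreal\<close>, so it can be moved
  to the other side before the infimum is taken.\<close>

lemma ennreal_le_mult_INF:
  fixes x :: ennreal
  assumes "c > 0" "\<And>i. i \<in> A \<Longrightarrow> x \<le> ennreal c * F i"
  shows "x \<le> ennreal c * (INF i\<in>A. F i)"
proof -
  have cancel: "ennreal (1 / c) * (ennreal c * y) = y" "ennreal c * (ennreal (1 / c) * y) = y" for y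
    using assms(1) by (simp_all flip: mult.assoc ennreal_mult)
  have "ennreal (1 / c) * x \<le> F i" if "i \<in> A" for i
    using mult_left_mono[OF assms(2)[OF that], of "ennreal (1 / c)"] by (simp add: cancel)
  then have "ennreal (1 / c) * x \<le> (INF i\<in>A. F i)"
    by (rule INF_greatest)
  from mult_left_mono[OF this, of "ennreal c"] show ?thesis
    by (simp add: cancel)
qed

lemma W_classD:
  assumes "\<eta> \<in> W_class"
  shows "\<lbrakk>0 \<le> s; s \<le> t\<rbrakk> \<Longrightarrow> \<eta> s \<le> \<eta> t" "0 \<le> t \<Longrightarrow> 0 \<le> \<eta> t" "\<eta> 0 = 0"
    "\<exists>D>0. \<forall>t>0. \<eta> (2 * t) \<le> D * \<eta> t"
  using assms unfolding W_class_def by (auto simp: mono_on_def)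

lemma standard_scheme_solid:
  assumes "standard_scheme f N \<nu>" "t \<in> f" "\<And>I. norm (s I) \<le> norm (t I)"
  shows "s \<in> f" "N s \<le> N t"
  using assms unfolding standard_scheme_def quasi_banach_lattice_def by blast+

lemma standard_scheme_quasi_norm:
  assumes "standard_scheme f N \<nu>"
  shows "(\<lambda>I. 0) \<in> f" "s \<in> f \<Longrightarrow> 0 \<le> N s" "s \<in> f \<Longrightarrow> N s = 0 \<longleftrightarrow> s = (\<lambda>I. 0)"
    "s \<in> f \<Longrightarrow> (\<lambda>I. c * s I) \<in> f" "s \<in> f \<Longrightarrow> N (\<lambda>I. c * s I) = norm c * N s"
  using assms
  unfolding standard_scheme_def quasi_banach_lattice_def linear_subspace_def quasi_norm_on_def
  by (simp_all only: simp_thms)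

lemma standard_scheme_sets:
  "standard_scheme f N \<nu> \<Longrightarrow> A \<in> sets \<nu>"
  unfolding standard_scheme_def by simp

lemma ext_norm_mono:
  assumes "standard_scheme f N \<nu>" "\<And>I. norm (s I) \<le> norm (t I)"
  shows "ext_norm f N s \<le> ext_norm f N t"
  unfolding ext_norm_def
  using standard_scheme_solid[OF assms(1) _ assms(2)] by (auto intro: ennreal_leI)

section \<open>The approximation error, and atoms of infinite measure\<close>

lemma zero_in_Sigma_set: "(\<lambda>I. 0) \<in> Sigma_set \<nu> t"
proof -
  have "(\<lambda>I. 0) = restrict_seq {} (\<lambda>I. 0)" "emeasure \<nu> {} \<le> ennreal t"
    by (simp_all add: restrict_seq_def)
  then show ?thesis unfolding Sigma_set_def by blast
qed

lemma Sigma_set_mono: "t \<le> t' \<Longrightarrow> Sigma_set \<nu> t \<subseteq> Sigma_set \<nu> t'"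
  unfolding Sigma_set_def by (blast intro: order_trans ennreal_leI)

lemma antimono_approx_error: "antimono (\<lambda>t. approx_error f N \<nu> t s)"
  unfolding approx_error_def by (intro antimonoI INF_superset_mono Sigma_set_mono) auto

lemma approx_error_le_ext_norm: "approx_error f N \<nu> t s \<le> ext_norm f N s"
  unfolding approx_error_def
  by (rule INF_lower2[OF zero_in_Sigma_set]) simp

lemma approx_error_Sigma_set:
  assumes "standard_scheme f N \<nu>" "s \<in> Sigma_set \<nu> t"
  shows "approx_error f N \<nu> t s = 0"
proof -
  have "approx_error f N \<nu> t s \<le> ext_norm f N (\<lambda>I. s I - s I)"
    unfolding approx_error_def by (rule INF_lower[OF assms(2)])
  also have "\<dots> = 0"
    using standard_scheme_quasi_norm[OF assms(1)] by (simp add: ext_norm_def)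
  finally show ?thesis by simp
qed

lemma Sigma_set_infinite_atom:
  assumes "standard_scheme f N \<nu>" "emeasure \<nu> {I} = \<infinity>" "r \<in> Sigma_set \<nu> t"
  shows "r I = 0"
proof -
  obtain \<Gamma> s where r: "r = restrict_seq \<Gamma> s" and \<Gamma>: "emeasure \<nu> \<Gamma> \<le> ennreal t"
    using assms(3) unfolding Sigma_set_def by blast
  have "I \<notin> \<Gamma>"
  proof
    assume "I \<in> \<Gamma>"
    then have "emeasure \<nu> {I} \<le> emeasure \<nu> \<Gamma>"
      by (intro emeasure_mono standard_scheme_sets[OF assms(1)]) auto
    then show False using \<Gamma> assms(2) by (simp add: top_unique)
  qed
  then show ?thesis by (simp add: r restrict_seq_def)
qed

text \<open>Approximants vanish at an atom I of infinite measure, so by solidity sigma(t, s) never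
  drops below ||s_I e_I||_f. If s_I were nonzero this bound would be positive, and t^xi times it is
  unbounded, which makes the approximation norm infinite.\<close>

lemma approx_norm_infinite_atom:
  assumes sch: "standard_scheme f N \<nu>" and "0 < \<mu>" "0 < \<xi>"
    and fin: "approx_norm \<xi> \<mu> f N \<nu> s < \<infinity>" and I: "emeasure \<nu> {I} = \<infinity>"
  shows "s I = 0"
proof (rule ccontr)
  assume sI: "s I \<noteq> 0"
  define a where "a = ext_norm f N (restrict_seq {I} s)"
  have "a > 0"
  proof (cases "restrict_seq {I} s \<in> f")
    case True
    have "restrict_seq {I} s \<noteq> (\<lambda>I. 0)"
      using sI by (auto simp: restrict_seq_def dest: fun_cong[of _ _ I])
    then show ?thesis
      using standard_scheme_quasi_norm(2,3)[OF sch True] True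
      by (simp add: a_def ext_norm_def order.strict_iff_order)
  qed (simp add: a_def ext_norm_def)
  have le: "a \<le> approx_error f N \<nu> t s" for t
    unfolding approx_error_def a_def
  proof (intro INF_greatest ext_norm_mono[OF sch])
    fix r J assume "r \<in> Sigma_set \<nu> t"
    from Sigma_set_infinite_atom[OF sch I this]
    show "norm (restrict_seq {I} s J) \<le> norm (s J - r J)" by (simp add: restrict_seq_def)
  qed
  obtain k where k: "k > 0" and lower:
    "\<And>g b T. T > 0 \<Longrightarrow> (\<And>t. t \<in> {T..2*T} \<Longrightarrow> b \<le> g t) \<Longrightarrow> ennreal k * b \<le> Lmu_norm \<mu> g"
    using Lmu_norm_lower[OF assms(2)] by meson
  have bound: "ennreal k * (ennreal y * a) \<le> approx_norm \<xi> \<mu> f N \<nu> s" if "y > 0" for y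
  proof -
    \<comment> \<open>With this T, t^xi >= y on all of [T, 2T].\<close>
    define T where "T = y powr (1 / \<xi>)"
    have T: "T > 0" "T powr \<xi> = y" using that assms(3) by (simp_all add: T_def powr_powr)
    show ?thesis unfolding approx_norm_def
    proof (rule lower[OF T(1)])
      fix t assume "t \<in> {T..2*T}"
      then have "y \<le> t powr \<xi>" using T assms(3) powr_mono2[of \<xi> T t] by auto
      then show "ennreal y * a \<le> ennreal (t powr \<xi>) * approx_error f N \<nu> t s"
        using le by (intro mult_mono ennreal_leI) auto
    qed
  qed
  have "a < \<infinity>"
  proof (rule ccontr)
    assume "\<not> a < \<infinity>"
    then have "a = \<infinity>" by (simp add: less_top[symmetric] infinity_ennreal_def)
    then show False using bound[of 1] k fin by (simp add: ennreal_mult_top infinity_ennreal_def)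
  qed
  then obtain b where b: "a = ennreal b" "b > 0"
    using \<open>a > 0\<close> by (cases a) (auto simp: infinity_ennreal_def)
  obtain B where B: "approx_norm \<xi> \<mu> f N \<nu> s = ennreal B" "B \<ge> 0"
    using fin by (cases "approx_norm \<xi> \<mu> f N \<nu> s") (auto simp: infinity_ennreal_def)
  \<comment> \<open>The value of y is the one for which the lower bound k y a exceeds the supposed
    norm B by 1.\<close>
  have "ennreal (B + 1) = ennreal k * (ennreal ((B + 1) / (k * b)) * a)"
    using k b B by (simp flip: ennreal_mult)
  also have "\<dots> \<le> ennreal B"
    using bound[of "(B + 1) / (k * b)"] k b B by simp
  finally show False using B by simp
qed

section \<open>The lower estimate implies the embedding: weak-type bound and rearrangements\<close>

text \<open>Continuity from below along an enumeration of the index set. It is used on level sets,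
  which may have infinite measure, where the lower estimate does not apply.\<close>

lemma finite_subset_emeasure_gt:
  fixes \<nu> :: "('d::countable) measure"
  assumes "sets \<nu> = UNIV" "emeasure \<nu> A > x"
  shows "\<exists>G. finite G \<and> G \<subseteq> A \<and> emeasure \<nu> G > x"
proof -
  define G where "G n = {I \<in> A. to_nat I < n}" for n
  have fin: "finite (G n)" for n
  proof (rule inj_on_finite[of to_nat _ "{..<n}"])
    show "inj_on to_nat (G n)" by (rule inj_on_subset[OF inj_to_nat]) simp
  qed (auto simp: G_def)
  have "(SUP n. emeasure \<nu> (G n)) = emeasure \<nu> (\<Union>n. G n)"
    using assms(1) by (intro SUP_emeasure_incseq) (auto simp: G_def incseq_def)
  also have "(\<Union>n. G n) = A" by (auto simp: G_def)
  finally obtain n where "emeasure \<nu> (G n) > x"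
    using assms(2) by (metis less_SUP_iff)
  then show ?thesis using fin[of n] by (intro exI[of _ "G n"]) (auto simp: G_def)
qed

text \<open>If a level set at height y had measure above tau, it would contain a finite G of finite
  measure above tau. On G one has y / u_I < |g_I|, so solidity, the lower estimate for G and
  monotonicity of eta give y eta(tau) <= C ||g||_f. Heights above C ||g||_f / eta(tau) are thus
  admissible in the infimum defining the rearrangement.\<close>

lemma lower_estimate_imp_weak_type:
  fixes f :: "('d::countable) cseq set"
  assumes sch: "standard_scheme f N \<nu>" and u: "weight_sequence u" and \<eta>: "\<eta> \<in> W_class"
    and C: "C > 0" and lower: "\<And>\<Gamma>. emeasure \<nu> \<Gamma> < \<infinity> \<Longrightarrow>
             ennreal (1 / C * \<eta> (measure \<nu> \<Gamma>))
               \<le> ext_norm f N (restrict_seq \<Gamma> (\<lambda>I. complex_of_real (1 / u I)))"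
    and g: "g \<in> f" "\<And>I. emeasure \<nu> {I} = \<infinity> \<Longrightarrow> g I = 0" and \<tau>: "\<tau> \<ge> 0"
  shows "ennreal (\<eta> \<tau>) * decr_rearr \<nu> (\<lambda>I. complex_of_real (u I) * g I) \<tau> \<le> ennreal (C * N g)"
proof (cases "\<eta> \<tau> = 0")
  case False
  then have \<eta>\<tau>: "\<eta> \<tau> > 0" using W_classD(2)[OF \<eta> \<tau>] by simp
  have u0: "u I > 0" for I using u by (simp add: weight_sequence_def)
  have sets_UNIV: "sets \<nu> = UNIV" using sch by (simp add: standard_scheme_def)
  have Ng: "N g \<ge> 0" by (rule standard_scheme_quasi_norm(2)[OF sch g(1)])
  have level: "emeasure \<nu> {I. norm (complex_of_real (u I) * g I) > y} \<le> ennreal \<tau>"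
    if y: "y > 0" "y > C * N g / \<eta> \<tau>" for y
  proof (rule ccontr)
    assume "\<not> ?thesis"
    then obtain G where G: "finite G" "G \<subseteq> {I. norm (complex_of_real (u I) * g I) > y}"
      "emeasure \<nu> G > ennreal \<tau>"
      using finite_subset_emeasure_gt[OF sets_UNIV, of "ennreal \<tau>"
          "{I. norm (complex_of_real (u I) * g I) > y}"] by (auto simp only: not_le)
    \<comment> \<open>On the level set g is nonzero, so G avoids the atoms of infinite measure;
      being finite, it then has finite measure.\<close>
    have "emeasure \<nu> {I} < \<infinity>" if "I \<in> G" for I
      using g(2)[of I] G(2) that y(1) by (auto simp: less_top[symmetric] infinity_ennreal_def)
    then have "(\<Sum>I\<in>G. emeasure \<nu> {I}) < \<infinity>"
      using G(1) by (simp add: infinity_ennreal_def ennreal_sum_less_top)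
    then have fin: "emeasure \<nu> G < \<infinity>"
      using emeasure_eq_sum_singleton[OF G(1), of \<nu>] standard_scheme_sets[OF sch] by auto
    then have eq: "emeasure \<nu> G = ennreal (measure \<nu> G)"
      by (simp add: emeasure_eq_ennreal_measure infinity_ennreal_def)
    have "\<tau> \<le> measure \<nu> G" using G(3) \<tau> unfolding eq by (simp add: ennreal_less_iff)
    then have "\<eta> \<tau> \<le> \<eta> (measure \<nu> G)" by (rule W_classD(1)[OF \<eta> \<tau>])
    define h where "h = restrict_seq G (\<lambda>I. complex_of_real (1 / u I))"
    have dom: "norm (complex_of_real y * h I) \<le> norm (g I)" for I
    proof (cases "I \<in> G")
      case True
      then have "y < u I * norm (g I)" using G(2) u0[of I] by (auto simp: norm_mult)
      then show ?thesis using True y(1) u0[of I]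
        by (simp add: h_def restrict_seq_def norm_mult norm_divide field_simps)
    qed (simp add: h_def restrict_seq_def)
    have "(\<lambda>I. complex_of_real y * h I) \<in> f" and Ny: "N (\<lambda>I. complex_of_real y * h I) \<le> N g"
      using standard_scheme_solid[OF sch g(1) dom] by auto
    \<comment> \<open>Scaling back by 1/y places h itself in f, so that \<open>ext_norm\<close> in
      the lower estimate is the real number \<open>N h\<close>.\<close>
    from standard_scheme_quasi_norm(4)[OF sch this(1), of "complex_of_real (1 / y)"]
    have hf: "h \<in> f" using y(1) by simp
    have "y * N h \<le> N g"
      using Ny standard_scheme_quasi_norm(5)[OF sch hf, of "complex_of_real y"] y(1) by simp
    moreover have "1 / C * \<eta> (measure \<nu> G) \<le> N h"
      using lower[OF fin, folded h_def] hf standard_scheme_quasi_norm(2)[OF sch hf]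
      by (simp add: ext_norm_def)
    ultimately have "y * (1 / C * \<eta> (measure \<nu> G)) \<le> N g"
      using y(1) by (meson mult_left_mono less_imp_le order_trans)
    then have "y * \<eta> (measure \<nu> G) \<le> C * N g" using C by (simp add: field_simps)
    with \<open>\<eta> \<tau> \<le> \<eta> (measure \<nu> G)\<close> y(1) have "y * \<eta> \<tau> \<le> C * N g"
      by (meson mult_left_mono less_imp_le order_trans)
    with y(2) \<eta>\<tau> show False by (simp add: field_simps)
  qed
  have "decr_rearr \<nu> (\<lambda>I. complex_of_real (u I) * g I) \<tau> \<le> ennreal (C * N g / \<eta> \<tau>)"
  \<comment> \<open>\<open>level\<close> covers only heights strictly above the threshold, which may
    moreover be 0; hence the passage through threshold + e.\<close>
  proof (rule ennreal_le_epsilon)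
    fix e :: real assume "e > 0"
    have nn: "C * N g / \<eta> \<tau> \<ge> 0" using C Ng \<eta>\<tau> by simp
    have "decr_rearr \<nu> (\<lambda>I. complex_of_real (u I) * g I) \<tau> \<le> ennreal (C * N g / \<eta> \<tau> + e)"
      unfolding decr_rearr_def using nn \<open>e > 0\<close>
      by (intro INF_lower CollectI conjI level) auto
    then show "decr_rearr \<nu> (\<lambda>I. complex_of_real (u I) * g I) \<tau> \<le> ennreal (C * N g / \<eta> \<tau>) + ennreal e"
      using nn \<open>e > 0\<close> by simp
  qed
  from mult_left_mono[OF this, of "ennreal (\<eta> \<tau>)"] show ?thesis
    using \<eta>\<tau> C Ng by (simp flip: ennreal_mult)
qed simp

text \<open>Off the support of r the sequences s and s - r agree, so each level set of ws is
  contained in that of w(s - r) together with a set of measure at most t.\<close>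

lemma decr_rearr_minus_Sigma_set:
  assumes sch: "standard_scheme f N \<nu>" and "r \<in> Sigma_set \<nu> t" "t \<ge> 0"
  shows "decr_rearr \<nu> (\<lambda>I. w I * s I) (2 * t) \<le> decr_rearr \<nu> (\<lambda>I. w I * (s I - r I)) t"
proof -
  obtain \<Gamma> r' where r: "r = restrict_seq \<Gamma> r'" and \<Gamma>: "emeasure \<nu> \<Gamma> \<le> ennreal t"
    using assms(2) unfolding Sigma_set_def by blast
  have "emeasure \<nu> {I. norm (w I * s I) > y} \<le> ennreal (2 * t)"
    if y: "emeasure \<nu> {I. norm (w I * (s I - r I)) > y} \<le> ennreal t" for y
  proof -
    have "emeasure \<nu> {I. norm (w I * s I) > y}
        \<le> emeasure \<nu> ({I. norm (w I * (s I - r I)) > y} \<union> \<Gamma>)"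
      by (intro emeasure_mono standard_scheme_sets[OF sch]) (auto simp: r restrict_seq_def)
    also have "\<dots> \<le> emeasure \<nu> {I. norm (w I * (s I - r I)) > y} + emeasure \<nu> \<Gamma>"
      by (intro emeasure_subadditive standard_scheme_sets[OF sch])
    also have "\<dots> \<le> ennreal t + ennreal t" using y \<Gamma> by (rule add_mono)
    also have "\<dots> = ennreal (2 * t)" using assms(3) by (simp flip: ennreal_plus)
    finally show ?thesis .
  qed
  then show ?thesis unfolding decr_rearr_def by (intro INF_superset_mono) auto
qed

text \<open>Splitting \<open>s = r + (s - r)\<close> with \<open>r \<in> \<Sigma>\<^sub>t\<close>, the first summand has vanishing rearrangement
  at \<open>t\<close>, so only the weak-type bound for \<open>s - r \<in> f\<close> enters and no dyadic summation is needed.\<close>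

lemma lower_estimate_imp_decr_rearr_le_approx_error:
  fixes f :: "('d::countable) cseq set"
  assumes sch: "standard_scheme f N \<nu>" and u: "weight_sequence u" and \<eta>: "\<eta> \<in> W_class"
    and C: "C > 0" and lower: "\<And>\<Gamma>. emeasure \<nu> \<Gamma> < \<infinity> \<Longrightarrow>
             ennreal (1 / C * \<eta> (measure \<nu> \<Gamma>))
               \<le> ext_norm f N (restrict_seq \<Gamma> (\<lambda>I. complex_of_real (1 / u I)))"
    and s: "\<And>I. emeasure \<nu> {I} = \<infinity> \<Longrightarrow> s I = 0" and t: "t > 0"
  shows "ennreal (\<eta> t) * decr_rearr \<nu> (\<lambda>I. complex_of_real (u I) * s I) (2 * t)
           \<le> ennreal C * approx_error f N \<nu> t s"
  unfolding approx_error_def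
proof (rule ennreal_le_mult_INF[OF C])
  fix r assume r: "r \<in> Sigma_set \<nu> t"
  have "ennreal (\<eta> t) * decr_rearr \<nu> (\<lambda>I. complex_of_real (u I) * s I) (2 * t)
      \<le> ennreal (\<eta> t) * decr_rearr \<nu> (\<lambda>I. complex_of_real (u I) * (s I - r I)) t"
    using t by (intro mult_left_mono decr_rearr_minus_Sigma_set[OF sch r]) auto
  also have "\<dots> \<le> ennreal C * ext_norm f N (\<lambda>I. s I - r I)"
  proof (cases "(\<lambda>I. s I - r I) \<in> f")
    case True
    have "ennreal (\<eta> t) * decr_rearr \<nu> (\<lambda>I. complex_of_real (u I) * (s I - r I)) t
        \<le> ennreal (C * N (\<lambda>I. s I - r I))"
      using t s Sigma_set_infinite_atom[OF sch _ r]
      by (intro lower_estimate_imp_weak_type[OF sch u \<eta> C lower True]) auto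
    then show ?thesis
      using True C standard_scheme_quasi_norm(2)[OF sch True] by (simp add: ext_norm_def ennreal_mult)
  next
    case False
    then show ?thesis using C by (simp add: ext_norm_def ennreal_mult_top infinity_ennreal_def)
  qed
  finally show "ennreal (\<eta> t) * decr_rearr \<nu> (\<lambda>I. complex_of_real (u I) * s I) (2 * t)
      \<le> ennreal C * ext_norm f N (\<lambda>I. s I - r I)" .
qed

lemma lower_estimate_imp_inclusion:
  fixes f :: "('d::countable) cseq set"
  assumes sch: "standard_scheme f N \<nu>" and u: "weight_sequence u" and \<eta>: "\<eta> \<in> W_class"
    and "0 < \<xi>" "0 < \<mu>" and C: "C > 0"
    and lower: "\<And>\<Gamma>. emeasure \<nu> \<Gamma> < \<infinity> \<Longrightarrow>
             ennreal (1 / C * \<eta> (measure \<nu> \<Gamma>))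
               \<le> ext_norm f N (restrict_seq \<Gamma> (\<lambda>I. complex_of_real (1 / u I)))"
  shows "continuous_inclusion
           (approx_space \<xi> \<mu> f N \<nu>) (approx_norm \<xi> \<mu> f N \<nu>)
           (wlorentz_xi_space \<mu> \<xi> \<eta> u \<nu>) (wlorentz_xi_norm \<mu> \<xi> \<eta> u \<nu>)"
proof -
  obtain D where D: "D > 0" "\<And>t. t > 0 \<Longrightarrow> \<eta> (2 * t) \<le> D * \<eta> t"
    using W_classD(4)[OF \<eta>] by blast
  \<comment> \<open>D comes from doubling eta, 2^xi from t^xi = 2^xi (t/2)^xi, and C from the
    pointwise bound at t/2.\<close>
  define K where "K = D * 2 powr \<xi> * C"
  have K: "K > 0" using D C by (simp add: K_def)
  have *: "wlorentz_xi_norm \<mu> \<xi> \<eta> u \<nu> s \<le> ennreal K * approx_norm \<xi> \<mu> f N \<nu> s"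
    if s: "s \<in> approx_space \<xi> \<mu> f N \<nu>" for s
    unfolding wlorentz_xi_norm_def wlorentz_norm_def lorentz_norm_def approx_norm_def
  proof (rule Lmu_norm_dilation_le[OF assms(5) K])
    have [measurable]: "(\<lambda>t. approx_error f N \<nu> t s) \<in> borel_measurable borel"
      by (rule borel_measurable_antimono_ennreal[OF antimono_approx_error])
    show "(\<lambda>t. ennreal (t powr \<xi>) * approx_error f N \<nu> t s) \<in> borel_measurable borel"
      by measurable
    fix t :: real assume t: "t > 0"
    define d where "d = decr_rearr \<nu> (\<lambda>I. complex_of_real (u I) * s I) t"
    have s0: "s I = 0" if "emeasure \<nu> {I} = \<infinity>" for I
      using s that approx_norm_infinite_atom[OF sch assms(5,4)] by (simp add: approx_space_def)
    have \<eta>t: "\<eta> (t/2) \<ge> 0" "\<eta> t \<le> D * \<eta> (t/2)" "t powr \<xi> = 2 powr \<xi> * (t/2) powr \<xi>"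
      using W_classD(2)[OF \<eta>, of "t/2"] D(2)[of "t/2"] t by (simp_all add: powr_divide)
    have "ennreal (t powr \<xi> * \<eta> t) * d \<le> ennreal (2 powr \<xi> * (t/2) powr \<xi> * (D * \<eta> (t/2))) * d"
      using \<eta>t(2) unfolding \<eta>t(3)
      by (intro mult_right_mono ennreal_leI mult_left_mono) auto
    also have "\<dots> = ennreal (2 powr \<xi> * (t/2) powr \<xi> * D) * (ennreal (\<eta> (t/2)) * d)"
      using \<eta>t(1) D(1) by (simp add: mult.assoc ennreal_mult)
    also have "\<dots> \<le> ennreal (2 powr \<xi> * (t/2) powr \<xi> * D) * (ennreal C * approx_error f N \<nu> (t/2) s)"
      using lower_estimate_imp_decr_rearr_le_approx_error[OF sch u \<eta> C lower s0, where t = "t/2"] t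
      by (intro mult_left_mono) (auto simp: d_def)
    also have "\<dots> = ennreal K * (ennreal ((t/2) powr \<xi>) * approx_error f N \<nu> (t/2) s)"
      using D(1) C by (simp add: K_def ennreal_mult ac_simps)
    finally show "ennreal (t powr \<xi> * \<eta> t) * decr_rearr \<nu> (\<lambda>I. complex_of_real (u I) * s I) t
        \<le> ennreal K * (ennreal ((t/2) powr \<xi>) * approx_error f N \<nu> (t/2) s)"
      by (simp add: d_def)
  qed
  moreover have "s \<in> wlorentz_xi_space \<mu> \<xi> \<eta> u \<nu>" if "s \<in> approx_space \<xi> \<mu> f N \<nu>" for s
    using *[OF that] that
    by (auto simp: approx_space_def wlorentz_xi_space_def infinity_ennreal_def
        ennreal_mult_less_top elim!: le_less_trans)
  ultimately show ?thesis using K unfolding continuous_inclusion_def by blast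
qed

section \<open>The embedding implies Bernstein's inequality\<close>

text \<open>On Sigma_t the approximation norm is itself at most a constant times t^xi ||s||_f, so
  the approximation space satisfies Bernstein's inequality, and any space into which it embeds
  inherits it.\<close>

lemma inclusion_imp_bernstein:
  assumes sch: "standard_scheme f N \<nu>" and "0 < \<xi>" "0 < \<mu>"
    and incl: "continuous_inclusion (approx_space \<xi> \<mu> f N \<nu>) (approx_norm \<xi> \<mu> f N \<nu>) B M"
  shows "bernstein_inequality \<xi> M f N \<nu>"
proof -
  obtain C where C: "C > 0" "\<And>s. s \<in> approx_space \<xi> \<mu> f N \<nu> \<Longrightarrow> M s \<le> ennreal C * approx_norm \<xi> \<mu> f N \<nu> s"
    using incl unfolding continuous_inclusion_def by blast
  obtain k where k: "k > 0" and upper: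
    "\<And>g a m. m > 0 \<Longrightarrow> (\<And>t. t > 0 \<Longrightarrow> g t \<le> (if t < m then ennreal (t powr \<xi>) * a else 0)) \<Longrightarrow>
            Lmu_norm \<mu> g \<le> ennreal (k * m powr \<xi>) * a"
    using Lmu_norm_upper[OF assms(3,2)] by meson
  have "M s \<le> ennreal (C * k * t powr \<xi>) * ext_norm f N s"
    if t: "t > 0" and s: "s \<in> Sigma_set \<nu> t" "s \<in> f" for t s
  proof -
    have "approx_norm \<xi> \<mu> f N \<nu> s \<le> ennreal (k * t powr \<xi>) * ext_norm f N s"
      unfolding approx_norm_def
    proof (rule upper[OF t])
      fix \<tau> :: real
      show "ennreal (\<tau> powr \<xi>) * approx_error f N \<nu> \<tau> s
          \<le> (if \<tau> < t then ennreal (\<tau> powr \<xi>) * ext_norm f N s else 0)"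
      proof (cases "\<tau> < t")
        case True
        then show ?thesis by (simp add: mult_left_mono approx_error_le_ext_norm)
      next
        case False
        then have "s \<in> Sigma_set \<nu> \<tau>" using s(1) Sigma_set_mono[of t \<tau> \<nu>] by auto
        then show ?thesis using False by (simp add: approx_error_Sigma_set[OF sch])
      qed
    qed
    moreover from this have "s \<in> approx_space \<xi> \<mu> f N \<nu>"
      using s(2) by (auto simp: approx_space_def ext_norm_def infinity_ennreal_def
          ennreal_mult_less_top elim!: le_less_trans)
    ultimately have "M s \<le> ennreal C * (ennreal (k * t powr \<xi>) * ext_norm f N s)"
      using C(2) by (meson mult_left_mono order_trans zero_le)
    also have "\<dots> = ennreal (C * k * t powr \<xi>) * ext_norm f N s"
      using C(1) k by (simp add: ennreal_mult mult.assoc)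
    finally show ?thesis .
  qed
  then show ?thesis using C(1) k unfolding bernstein_inequality_def
    by (intro exI[of _ "C * k"]) auto
qed

section \<open>Bernstein's inequality implies the lower estimate\<close>

lemma bernstein_imp_lower_estimate:
  assumes sch: "standard_scheme f N \<nu>" and u: "weight_sequence u" and \<eta>: "\<eta> \<in> W_class"
    and "0 < \<xi>" "0 < \<mu>" and bern: "bernstein_inequality \<xi> (wlorentz_xi_norm \<mu> \<xi> \<eta> u \<nu>) f N \<nu>"
  shows "\<exists>C>0. \<forall>\<Gamma>. emeasure \<nu> \<Gamma> < \<infinity> \<longrightarrow>
             ennreal (1 / C * \<eta> (measure \<nu> \<Gamma>))
               \<le> ext_norm f N (restrict_seq \<Gamma> (\<lambda>I. complex_of_real (1 / u I)))"
proof -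
  obtain D where D: "D > 0" "\<And>t. t > 0 \<Longrightarrow> \<eta> (2 * t) \<le> D * \<eta> t"
    using W_classD(4)[OF \<eta>] by blast
  obtain C where C: "C > 0" "\<And>t s. t > 0 \<Longrightarrow> s \<in> Sigma_set \<nu> t \<Longrightarrow> s \<in> f \<Longrightarrow>
      wlorentz_xi_norm \<mu> \<xi> \<eta> u \<nu> s \<le> ennreal (C * t powr \<xi>) * ext_norm f N s"
    using bern unfolding bernstein_inequality_def by blast
  obtain k where k: "k > 0" and klow:
    "\<And>g b T. T > 0 \<Longrightarrow> (\<And>t. t \<in> {T..2*T} \<Longrightarrow> b \<le> g t) \<Longrightarrow> ennreal k * b \<le> Lmu_norm \<mu> g"
    using Lmu_norm_lower[OF assms(5)] by meson
  have u0: "u I > 0" for I using u by (simp add: weight_sequence_def)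
  \<comment> \<open>D^2 pays for two doublings from m/4 to m, 4^xi for replacing (m/4)^xi by m^xi,
    and 1/k for the lower bound of the L^mu norm.\<close>
  define K where "K = D\<^sup>2 * C * 4 powr \<xi> / k"
  have K: "K > 0" using D C k by (simp add: K_def)
  have "ennreal (1 / K * \<eta> (measure \<nu> \<Gamma>))
               \<le> ext_norm f N (restrict_seq \<Gamma> (\<lambda>I. complex_of_real (1 / u I)))"
    if fin: "emeasure \<nu> \<Gamma> < \<infinity>" for \<Gamma>
  proof -
    define m where "m = measure \<nu> \<Gamma>"
    define s where "s = restrict_seq \<Gamma> (\<lambda>I. complex_of_real (1 / u I))"
    have em: "emeasure \<nu> \<Gamma> = ennreal m" using fin
      by (simp add: m_def emeasure_eq_ennreal_measure infinity_ennreal_def)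
    have "m \<ge> 0" by (simp add: m_def)
    \<comment> \<open>Outside f the right-hand side is infinite; m = 0 is split off because
      Bernstein's inequality is applied at t = m and requires t > 0.\<close>
    then consider "s \<notin> f" | "m = 0" | "s \<in> f" "m > 0" by linarith
    then have "ennreal (1 / K * \<eta> m) \<le> ext_norm f N s"
    proof cases
      case 1
      then show ?thesis by (simp add: ext_norm_def)
    next
      case 2
      then show ?thesis using W_classD(3)[OF \<eta>] by simp
    next
      case 3
      have Ns: "N s \<ge> 0" by (rule standard_scheme_quasi_norm(2)[OF sch 3(1)])
      have \<eta>4: "\<eta> (m/4) \<ge> 0" using W_classD(2)[OF \<eta>] 3(2) by simp
      have "ennreal k * ennreal ((m/4) powr \<xi> * \<eta> (m/4)) \<le> wlorentz_xi_norm \<mu> \<xi> \<eta> u \<nu> s"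
        unfolding wlorentz_xi_norm_def wlorentz_norm_def lorentz_norm_def
      \<comment> \<open>The window [m/4, m/2] stays strictly below m: the rearrangement of the
        indicator of Gamma is at least 1 only for t < m, so [m/2, m] would already fail at its right
        end.\<close>
      proof (rule klow)
        show "m / 4 > 0" using 3(2) by simp
        fix t assume t: "t \<in> {m / 4..2 * (m / 4)}"
        have "(m/4) powr \<xi> * \<eta> (m/4) \<le> t powr \<xi> * \<eta> t"
          using t 3(2) \<eta>4 assms(4) W_classD(1)[OF \<eta>, of "m/4" t]
          by (intro mult_mono powr_mono2) auto
        moreover have "1 \<le> decr_rearr \<nu> (\<lambda>I. complex_of_real (u I) * s I) t"
          unfolding decr_rearr_def
        proof (rule INF_greatest)
          fix y assume "y \<in> {y::real. y > 0 \<and>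
              emeasure \<nu> {I. norm (complex_of_real (u I) * s I) > y} \<le> ennreal t}"
          then have y: "emeasure \<nu> {I. norm (complex_of_real (u I) * s I) > y} \<le> ennreal t" by simp
          have "y \<ge> 1"
          proof (rule ccontr)
            assume "\<not> y \<ge> 1"
            \<comment> \<open>On Gamma the weighted sequence equals 1, so a height y < 1 has a level
              set of measure at least m > t.\<close>
            then have "\<Gamma> \<subseteq> {I. norm (complex_of_real (u I) * s I) > y}"
              using u0 by (auto simp: s_def restrict_seq_def norm_divide less_imp_neq[OF u0, symmetric])
            then have "emeasure \<nu> \<Gamma> \<le> ennreal t"
              using y by (meson emeasure_mono standard_scheme_sets[OF sch] order_trans)
            then show False using t 3(2) by (simp add: em)
          qed
          then show "1 \<le> ennreal y" by simp
        qed
        ultimately show "ennreal ((m/4) powr \<xi> * \<eta> (m/4))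
            \<le> ennreal (t powr \<xi> * \<eta> t) * decr_rearr \<nu> (\<lambda>I. complex_of_real (u I) * s I) t"
          using mult_mono[OF ennreal_leI, of _ _ 1] by fastforce
      qed
      also have "\<dots> \<le> ennreal (C * m powr \<xi>) * ext_norm f N s"
      proof (rule C(2)[OF 3(2) _ 3(1)])
        show "s \<in> Sigma_set \<nu> m" using em unfolding Sigma_set_def s_def by force
      qed
      also have "\<dots> = ennreal (C * m powr \<xi> * N s)"
        using 3(1) Ns C(1) by (simp add: ext_norm_def ennreal_mult)
      finally have "k * ((m/4) powr \<xi> * \<eta> (m/4)) \<le> C * m powr \<xi> * N s"
        using k \<eta>4 Ns C(1) by (simp flip: ennreal_mult)
      then have "m powr \<xi> * (k * \<eta> (m/4)) \<le> m powr \<xi> * (C * 4 powr \<xi> * N s)"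
        using 3(2) by (simp add: powr_divide field_simps)
      then have *: "k * \<eta> (m/4) \<le> C * 4 powr \<xi> * N s"
        using 3(2) by simp
      have "\<eta> m \<le> D * \<eta> (m/2)" using D(2)[of "m/2"] 3(2) by simp
      also have "\<dots> \<le> D * (D * \<eta> (m/4))" using D(1) D(2)[of "m/4"] 3(2) by (intro mult_left_mono) auto
      finally have "k * \<eta> m \<le> D\<^sup>2 * (k * \<eta> (m/4))" using k by (simp add: power2_eq_square)
      also have "\<dots> \<le> D\<^sup>2 * (C * 4 powr \<xi> * N s)" using * by (intro mult_left_mono) auto
      finally have "1 / K * \<eta> m \<le> N s" using D C k by (simp add: K_def field_simps)
      then show ?thesis using 3(1) by (simp add: ext_norm_def ennreal_leI)
    qed
    then show ?thesis by (simp add: m_def s_def)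
  qed
  then show ?thesis using K by blast
qed

theorem theorem2p7p2:
  fixes f :: "('d::countable) cseq set"
    and N :: "'d cseq \<Rightarrow> real"
    and \<nu> :: "'d measure"
    and u :: "'d \<Rightarrow> real"
    and \<xi> :: real
    and \<mu> :: ennreal
    and \<eta> :: "real \<Rightarrow> real"
  assumes "standard_scheme f N \<nu>"
    and "weight_sequence u"
    and "0 < \<xi>"
    and "0 < \<mu>"
    and "\<eta> \<in> W_class"
  shows "((\<exists>C>0. \<forall>\<Gamma>. emeasure \<nu> \<Gamma> < \<infinity> \<longrightarrow>
             ennreal (1 / C * \<eta> (measure \<nu> \<Gamma>))
               \<le> ext_norm f N (restrict_seq \<Gamma> (\<lambda>I. complex_of_real (1 / u I))))
          \<longleftrightarrow> bernstein_inequality \<xi> (wlorentz_xi_norm \<mu> \<xi> \<eta> u \<nu>) f N \<nu>)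
       \<and> (bernstein_inequality \<xi> (wlorentz_xi_norm \<mu> \<xi> \<eta> u \<nu>) f N \<nu>
          \<longleftrightarrow> continuous_inclusion
                (approx_space \<xi> \<mu> f N \<nu>) (approx_norm \<xi> \<mu> f N \<nu>)
                (wlorentz_xi_space \<mu> \<xi> \<eta> u \<nu>) (wlorentz_xi_norm \<mu> \<xi> \<eta> u \<nu>))"
proof -
  let ?lower = "\<exists>C>0. \<forall>\<Gamma>. emeasure \<nu> \<Gamma> < \<infinity> \<longrightarrow>
             ennreal (1 / C * \<eta> (measure \<nu> \<Gamma>))
               \<le> ext_norm f N (restrict_seq \<Gamma> (\<lambda>I. complex_of_real (1 / u I)))"
  let ?bernstein = "bernstein_inequality \<xi> (wlorentz_xi_norm \<mu> \<xi> \<eta> u \<nu>) f N \<nu>"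
  let ?inclusion = "continuous_inclusion
      (approx_space \<xi> \<mu> f N \<nu>) (approx_norm \<xi> \<mu> f N \<nu>)
      (wlorentz_xi_space \<mu> \<xi> \<eta> u \<nu>) (wlorentz_xi_norm \<mu> \<xi> \<eta> u \<nu>)"
  have "?lower \<Longrightarrow> ?inclusion"
    using lower_estimate_imp_inclusion[OF assms(1,2,5,3,4)] by blast
  moreover have "?inclusion \<Longrightarrow> ?bernstein"
    by (rule inclusion_imp_bernstein[OF assms(1,3,4)])
  moreover have "?bernstein \<Longrightarrow> ?lower"
    by (rule bernstein_imp_lower_estimate[OF assms(1,2,5,3,4)])
  ultimately show ?thesis by blast
qed

end
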